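(* Let $\mathbf X=(X_0,\dots,X_{N-1})$ be a random vector with likelihood $p(\mathbf X\mid\boldsymbol\theta)$, $\boldsymbol\theta=(\theta_0,\dots,\theta_{N-1})$, and suppose the following four conditions hold. ($A^*$) (Hierarchy of recursive partitions.) There is a hierarchy of recursively defined partitions $\cdots\mathcal P_{\ell-1}\prec\mathcal P_\ell\prec\mathcal P_{\ell+1}\cdots$, beginning with $[0,1)$ and ending with a complete recursive partition $\mathcal P^*=\{I_i\}_{i=0}^{N-1}$. ($B^*$) (Independence within $\mathcal P^*$.) The components of $\mathbf X$ are statistically independent, the components of $\boldsymbol\theta$ are $L$-independent with respect to the likelihood of $\mathbf X$, that is, $p(\mathbf X\mid\boldsymbol\theta)=\prod_{i=0}^{N-1}p(X_i\mid\theta_i)$, and the density of each $X_i$ is a member of some common parametric family $\mathcal F=\{p(\cdot\mid\theta):\theta\in\Theta\subseteq\mathbb R\}$. ($C^*$) (Reproducibility between partitions.) The family $\mathcal F$ is reproducible in $\theta$, in the sense that for all $I\in\mathcal I(\mathcal P^* )$ and all parameter vectors in $\Theta^{N_I}$, the density of $X_I=\sum_{i/N\in I}X_i$ is $p(X_I\mid\theta_I)\in\mathcal F$, where $\theta_I=\sum_{i/N\in I}\theta_i$. ($D^*$) (Decoupling of parameters with partitions, i.e., cuts.) For any $X_i\sim p(\cdot\mid\theta_i)\in\mathcal F$, $i\in\{i_1,i_2\}$, there exists some reparameterization $(\theta_{i_1},\theta_{i_2})\to(\theta,\omega)$ such that $$p(X_{i_1},X_{i_2}\mid\theta_{i_1},\theta_{i_2})=p(X\mid\theta)\,p(X_{i_1}\mid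 X,\omega),$$ where $X=X_{i_1}+X_{i_2}$ and $\theta=\theta_{i_1}+\theta_{i_2}$; that is, the sum $X$ is a cut for $(X_{i_1},X_{i_2})$. Then there exists a factorization of the form $$p(\mathbf X\mid\boldsymbol\theta)=p(X_{I_{00}}\mid\theta_{I_{00}})\prod_{I\in\mathcal I_{\mathrm{NT}}(\mathcal P^* )}p(X_{\mathrm{ch}(I),\mathrm l}\mid X_I,\omega_I)$$ with respect to some reparameterization $\{\theta_{I_{00}},\boldsymbol\omega\}$ of $\boldsymbol\theta$, where $I_{00}=[0,1)$, $\theta_{I_{00}}=\sum_{i=0}^{N-1}\theta_i$ and $\boldsymbol\omega=(\omega_I)_{I\in\mathcal I_{\mathrm{NT}}(\mathcal P^* )}$.
   Context: The notation $p(\cdot)$ is used generically for densities (continuous or discrete, possibly conditional) with respect to an appropriate dominating measure $\nu$. $I_i=[i/N,(i+1)/N)$ for $i=0,\dots,N-1$. Recursive partitions: start with the trivial partition $[0,1)$ and split it in two at one of the points $\{i/N\}_{i=1}^{N-1}$. Given a partition $\mathcal P$ intermediate between $[0,1)$ and $\{I_i\}_{i=0}^{N-1}$, refine it by splitting one and only one interval $I\in\mathcal P$ at one of the points of $\{i/N\}_{i=1}^{N-1}$ in the interior of $I$; $I$ is the parent, and the two subintervals are its left and right children $I_{\mathrm{ch}(I),\mathrm l}$, $I_{\mathrm{ch}(I),\mathrm r}$. Continuing until $\mathcal P^*=\{I_i\}_{i=0}^{N-1}$ is reached yields a complete recursive partition (C-RP); a C-RP $\mathcal P^*$ is understood together with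 the sequence of partitions leading to it. $\mathcal P\prec\mathcal P'$ means $\mathcal P'$ is produced further along in this recursive process than $\mathcal P$ (a refinement); $\preceq$ allows equality. For $\mathcal P\preceq\mathcal P^*$, $\mathcal I(\mathcal P)$ is the collection of all intervals found in at least one partition $\mathcal P'\preceq\mathcal P$, and $\mathcal I_{\mathrm{NT}}(\mathcal P)$ is the collection of those (nonterminal) intervals in $\mathcal I(\mathcal P)$ that are not in $\mathcal P$ itself. $N_I=\#\{i:I_i\subseteq I\}$. For $I\in\mathcal I(\mathcal P^* )$, $X_I=\sum_{i/N\in I}X_i$ and $\theta_I=\sum_{i/N\in I}\theta_i$; $X_{\mathrm{ch}(I),\mathrm l}$ is $X_{I'}$ for $I'=I_{\mathrm{ch}(I),\mathrm l}$. $L$-independence of the components of $\boldsymbol\theta$: the domain of variation of $\boldsymbol\theta$ equals the product of the domains of its components, and the role of $\boldsymbol\theta$ in the likelihood $p(\mathbf X\mid\boldsymbol\theta)$ separates in one-to-one correspondence with the statistically independent likelihood components of the $X_i$. *)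

theory Defs
  imports "HOL-Probability.Probability"
begin

section \<open>Recursive dyadic-free partitions of the unit interval\<close>

definition cell :: "nat \<Rightarrow> nat \<Rightarrow> real set" where
  "cell N i = {real i / real N ..< real (i + 1) / real N}"

definition splits_into :: "nat \<Rightarrow> real set \<Rightarrow> real set \<Rightarrow> real set \<Rightarrow> bool" where
  "splits_into N I L R \<longleftrightarrow>
     (\<exists>k\<in>{1..<N}. real k / real N \<in> interior I \<and>
        L = I \<inter> {..<real k / real N} \<and> R = I \<inter> {real k / real N..})"

definition refines_at ::
    "nat \<Rightarrow> real set set \<Rightarrow> real set \<Rightarrow> real set \<Rightarrow> real set \<Rightarrow> real set set \<Rightarrow> bool" where
  "refines_at N P I L R P' \<longleftrightarrow> I \<in> P \<and> splits_into N I L R \<and> P' = (P - {I}) \<union> {L, R}"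

text \<open>A complete recursive partition is represented by the whole list of partitions leading to it;
  the list order is the order \<open>\<prec>\<close> and the last entry is the partition into cells.\<close>

definition complete_recursive_partition :: "nat \<Rightarrow> real set set list \<Rightarrow> bool" where
  "complete_recursive_partition N Ps \<longleftrightarrow>
     Ps \<noteq> [] \<and> hd Ps = {{0..<1}} \<and>
     successively (\<lambda>P P'. \<exists>I L R. refines_at N P I L R P') Ps \<and>
     last Ps = cell N ` {..<N}"

definition intervals :: "real set set list \<Rightarrow> real set set" where
  "intervals Ps = \<Union> (set Ps)"

definition nonterminal_intervals :: "real set set list \<Rightarrow> real set set" where
  "nonterminal_intervals Ps = intervals Ps - last Ps"

definition children :: "nat \<Rightarrow> real set set list \<Rightarrow> real set \<Rightarrow> real set \<Rightarrow> real set \<Rightarrow> bool" where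
  "children N Ps I L R \<longleftrightarrow>
     (\<exists>j. Suc j < length Ps \<and> refines_at N (Ps ! j) I L R (Ps ! Suc j))"

text \<open>Each nonterminal interval is split exactly once, so the description below is unique for
  \<open>I \<in> nonterminal_intervals Ps\<close>; it carries no information for other \<open>I\<close>.\<close>

definition left_child :: "nat \<Rightarrow> real set set list \<Rightarrow> real set \<Rightarrow> real set" where
  "left_child N Ps I = (THE L. \<exists>R. children N Ps I L R)"

definition idx :: "nat \<Rightarrow> real set \<Rightarrow> nat set" where
  "idx N I = {i. i < N \<and> real i / real N \<in> I}"

text \<open>\<open>agg N I x\<close> is used both for \<open>X\<^sub>I\<close> (with data \<open>x\<close>) and for \<open>\<theta>\<^sub>I\<close> (with parameters \<open>x\<close>).\<close>

definition agg :: "nat \<Rightarrow> real set \<Rightarrow> (nat \<Rightarrow> real) \<Rightarrow> real" where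
  "agg N I x = (\<Sum>i\<in>idx N I. x i)"


section \<open>Densities and conditional densities\<close>

text \<open>Densities on \<open>\<real>\<close> are taken with respect to \<open>\<nu>\<close>. Conditional densities of a summand
  given the sum \<open>s\<close> are taken with respect to \<open>\<kappa> s\<close>, where \<open>\<kappa>\<close> disintegrates \<open>\<nu> \<Otimes> \<nu>\<close> along
  \<open>(x, y) \<mapsto> x + y\<close>. This is what makes ``joint = marginal times conditional'' an identity between
  functions of \<open>(x, y)\<close>. For Lebesgue measure and for counting measure on the integers
  \<open>\<kappa> s = \<nu>\<close> (lemmas below); for counting measure on the naturals \<open>\<kappa> s\<close> is counting measure
  on \<open>{0..s}\<close>.\<close>

definition dominating_measures :: "real measure \<Rightarrow> (real \<Rightarrow> real measure) \<Rightarrow> bool" where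
  "dominating_measures \<nu> \<kappa> \<longleftrightarrow>
     sigma_finite_measure \<nu> \<and> sets \<nu> = sets borel \<and> (\<forall>s. sets (\<kappa> s) = sets borel) \<and>
     (\<forall>f \<in> borel_measurable (borel \<Otimes>\<^sub>M borel).
        (\<lambda>s. \<integral>\<^sup>+ y. f (s, y) \<partial>\<kappa> s) \<in> borel_measurable borel \<and>
        (\<integral>\<^sup>+ x. (\<integral>\<^sup>+ y. f (x + y, x) \<partial>\<nu>) \<partial>\<nu>) = (\<integral>\<^sup>+ s. (\<integral>\<^sup>+ y. f (s, y) \<partial>\<kappa> s) \<partial>\<nu>))"

lemma dominating_measures_lborel: "dominating_measures lborel (\<lambda>_. lborel)"
  unfolding dominating_measures_def
proof (intro conjI ballI allI)
  fix f :: "real \<times> real \<Rightarrow> ennreal" assume [measurable]: "f \<in> borel_measurable (borel \<Otimes>\<^sub>M borel)"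
  show "(\<lambda>s. \<integral>\<^sup>+ y. f (s, y) \<partial>lborel) \<in> borel_measurable borel" by measurable
  have "(\<integral>\<^sup>+ x. (\<integral>\<^sup>+ y. f (x + y, x) \<partial>lborel) \<partial>lborel)
      = (\<integral>\<^sup>+ x. (\<integral>\<^sup>+ s. f (s, x) \<partial>lborel) \<partial>lborel)"
  proof (rule nn_integral_cong)
    fix x :: real
    have "(\<integral>\<^sup>+ s. f (s, x) \<partial>lborel) = (\<integral>\<^sup>+ s. f (s, x) \<partial>distr lborel borel ((+) x))"
      by (simp add: lborel_distr_plus)
    also have "\<dots> = (\<integral>\<^sup>+ y. f (x + y, x) \<partial>lborel)"
      by (subst nn_integral_distr) auto
    finally show "(\<integral>\<^sup>+ y. f (x + y, x) \<partial>lborel) = (\<integral>\<^sup>+ s. f (s, x) \<partial>lborel)" by simp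
  qed
  also have "\<dots> = (\<integral>\<^sup>+ s. (\<integral>\<^sup>+ y. f (s, y) \<partial>lborel) \<partial>lborel)"
    by (rule lborel_pair.Fubini') simp
  finally show "(\<integral>\<^sup>+ x. (\<integral>\<^sup>+ y. f (x + y, x) \<partial>lborel) \<partial>lborel)
      = (\<integral>\<^sup>+ s. (\<integral>\<^sup>+ y. f (s, y) \<partial>lborel) \<partial>lborel)" .
qed (auto intro: sigma_finite_lborel)

lemma dominating_measures_count_int:
  defines "\<nu> \<equiv> distr (count_space (UNIV :: int set)) borel real_of_int"
  shows "dominating_measures \<nu> (\<lambda>_. \<nu>)"
proof -
  interpret C: sigma_finite_measure "count_space (UNIV :: int set)"
    by (rule sigma_finite_measure_count_space)
  have em: "emeasure \<nu> A = emeasure (count_space UNIV) (real_of_int -` A)" if "A \<in> sets borel" for A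
    using that unfolding \<nu>_def by (subst emeasure_distr) auto
  have sf: "sigma_finite_measure \<nu>"
  proof
    let ?A = "insert (- \<int>) (range (\<lambda>n :: int. {real_of_int n}))"
    have cl: "(\<int> :: real set) \<in> sets borel" by (simp add: closed_Ints)
    have "emeasure \<nu> a \<noteq> \<infinity>" if a: "a \<in> ?A" for a
    proof -
      have "real_of_int -` a = {} \<or> (\<exists>n. real_of_int -` a = {n})" using a by auto
      moreover have "a \<in> sets borel" using a cl by auto
      ultimately show ?thesis by (auto simp: em)
    qed
    moreover have "\<Union> ?A = UNIV" by (auto simp: Ints_def)
    moreover have "?A \<subseteq> sets \<nu>" using cl by (auto simp: \<nu>_def)
    moreover have "countable ?A" by simp
    ultimately show "\<exists>A. countable A \<and> A \<subseteq> sets \<nu> \<and> \<Union> A = space \<nu> \<and> (\<forall>a\<in>A. emeasure \<nu> a \<noteq> \<infinity>)"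
      by (intro exI[of _ ?A]) (auto simp: \<nu>_def)
  qed
  then interpret sigma_finite_measure \<nu> .
  have sets: "sets \<nu> = sets borel" by (simp add: \<nu>_def)
  have nn: "(\<integral>\<^sup>+ x. h x \<partial>\<nu>) = (\<integral>\<^sup>+ n. h (real_of_int n) \<partial>count_space UNIV)"
    if "h \<in> borel_measurable borel" for h :: "real \<Rightarrow> ennreal"
    using that unfolding \<nu>_def by (subst nn_integral_distr) auto
  show ?thesis
    unfolding dominating_measures_def
  proof (intro conjI ballI allI)
    fix f :: "real \<times> real \<Rightarrow> ennreal" assume f[measurable]: "f \<in> borel_measurable (borel \<Otimes>\<^sub>M borel)"
    note sets[measurable_cong]
    show m[measurable]: "(\<lambda>s. \<integral>\<^sup>+ y. f (s, y) \<partial>\<nu>) \<in> borel_measurable borel" by measurable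
    have "(\<integral>\<^sup>+ x. (\<integral>\<^sup>+ y. f (x + y, x) \<partial>\<nu>) \<partial>\<nu>)
        = (\<integral>\<^sup>+ n. (\<integral>\<^sup>+ m. f (real_of_int (n + m), real_of_int n) \<partial>count_space UNIV) \<partial>count_space UNIV)"
      by (simp add: nn)
    also have "\<dots> = (\<integral>\<^sup>+ n. (\<integral>\<^sup>+ s. f (real_of_int s, real_of_int n) \<partial>count_space UNIV) \<partial>count_space UNIV)"
    proof (rule nn_integral_cong)
      fix n :: int
      show "(\<integral>\<^sup>+ m. f (real_of_int (n + m), real_of_int n) \<partial>count_space UNIV)
          = (\<integral>\<^sup>+ s. f (real_of_int s, real_of_int n) \<partial>count_space UNIV)"
        by (rule nn_integral_bij_count_space[where f = "\<lambda>s. f (real_of_int s, real_of_int n)"])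
          (rule bij_betwI[of _ _ _ "\<lambda>s. s - n"], auto)
    qed
    also have "\<dots> = (\<integral>\<^sup>+ s. (\<integral>\<^sup>+ n. f (real_of_int s, real_of_int n) \<partial>count_space UNIV) \<partial>count_space UNIV)"
      by (rule nn_integral_count_space_nn_integral) auto
    also have "\<dots> = (\<integral>\<^sup>+ s. (\<integral>\<^sup>+ y. f (s, y) \<partial>\<nu>) \<partial>\<nu>)"
      by (simp add: nn)
    finally show "(\<integral>\<^sup>+ x. (\<integral>\<^sup>+ y. f (x + y, x) \<partial>\<nu>) \<partial>\<nu>) = (\<integral>\<^sup>+ s. (\<integral>\<^sup>+ y. f (s, y) \<partial>\<nu>) \<partial>\<nu>)" .
  qed (auto simp: sf sets)
qed

text \<open>\<open>g s\<close> is the density of \<open>Y\<close> given \<open>S = s\<close>, with respect to \<open>\<kappa> s\<close>.\<close>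

definition conditional_density ::
    "'a measure \<Rightarrow> (real \<Rightarrow> real measure) \<Rightarrow> ('a \<Rightarrow> real) \<Rightarrow> ('a \<Rightarrow> real) \<Rightarrow>
     (real \<Rightarrow> real \<Rightarrow> real) \<Rightarrow> bool" where
  "conditional_density M \<kappa> S Y g \<longleftrightarrow>
     S \<in> borel_measurable M \<and> Y \<in> borel_measurable M \<and>
     (\<lambda>(s, y). g s y) \<in> borel_measurable (borel \<Otimes>\<^sub>M borel) \<and> (\<forall>s y. 0 \<le> g s y) \<and>
     (\<forall>A\<in>sets borel. \<forall>B\<in>sets borel.
        emeasure M {a \<in> space M. S a \<in> A \<and> Y a \<in> B} =
        (\<integral>\<^sup>+ a. indicator A (S a) *
           (\<integral>\<^sup>+ y. ennreal (g (S a) y) * indicator B y \<partial>\<kappa> (S a)) \<partial>M))"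

text \<open>The family \<open>{p \<theta> | \<theta> \<in> \<Theta>}\<close>; values of \<open>p\<close> outside \<open>\<Theta>\<close> are irrelevant.\<close>

definition density_family ::
    "real measure \<Rightarrow> real set \<Rightarrow> (real \<Rightarrow> real \<Rightarrow> real) \<Rightarrow> bool" where
  "density_family \<nu> \<Theta> p \<longleftrightarrow>
     (\<forall>\<theta>\<in>\<Theta>. p \<theta> \<in> borel_measurable borel \<and> (\<forall>x. 0 \<le> p \<theta> x) \<and> prob_space (density \<nu> (p \<theta>)))"


section \<open>The structural conditions\<close>

text \<open>\<open>D\<close> is the domain of variation of the parameter vector, \<open>lik \<theta>\<close> the joint density of the
  data vector with respect to the product of \<open>N\<close> copies of \<open>\<nu>\<close>.\<close>

definition L_independent ::
    "nat \<Rightarrow> real measure \<Rightarrow> (real \<Rightarrow> real \<Rightarrow> real) \<Rightarrow> (nat \<Rightarrow> real) set \<Rightarrow>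
     ((nat \<Rightarrow> real) \<Rightarrow> (nat \<Rightarrow> real) \<Rightarrow> real) \<Rightarrow> bool" where
  "L_independent N \<nu> p D lik \<longleftrightarrow>
     D = (\<Pi>\<^sub>E i\<in>{..<N}. (\<lambda>\<theta>. \<theta> i) ` D) \<and>
     (\<forall>\<theta>\<in>D. AE x in (\<Pi>\<^sub>M i\<in>{..<N}. \<nu>). lik \<theta> x = (\<Prod>i<N. p (\<theta> i) (x i)))"

definition reproducible ::
    "nat \<Rightarrow> real set set list \<Rightarrow> real measure \<Rightarrow> real set \<Rightarrow> (real \<Rightarrow> real \<Rightarrow> real) \<Rightarrow> bool" where
  "reproducible N Ps \<nu> \<Theta> p \<longleftrightarrow>
     (\<forall>I\<in>intervals Ps. \<forall>\<theta> \<in> (\<Pi>\<^sub>E i\<in>idx N I. \<Theta>).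
        agg N I \<theta> \<in> \<Theta> \<and>
        distributed (\<Pi>\<^sub>M i\<in>idx N I. density \<nu> (p (\<theta> i))) \<nu> (agg N I) (p (agg N I \<theta>)))"

text \<open>\<open>q \<omega> s\<close> is the conditional density of the first summand given that the sum is \<open>s\<close>, with
  parameter \<open>\<omega>\<close>. The reparameterization \<open>(\<theta>\<^sub>1, \<theta>\<^sub>2) \<mapsto> (\<theta>\<^sub>1 + \<theta>\<^sub>2, w \<theta>\<^sub>1 \<theta>\<^sub>2)\<close> is required to be
  one-to-one.\<close>

definition sums_are_cuts ::
    "real measure \<Rightarrow> (real \<Rightarrow> real measure) \<Rightarrow> real set \<Rightarrow> (real \<Rightarrow> real \<Rightarrow> real) \<Rightarrow>
     ('w \<Rightarrow> real \<Rightarrow> real \<Rightarrow> real) \<Rightarrow> bool" where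
  "sums_are_cuts \<nu> \<kappa> \<Theta> p q \<longleftrightarrow>
     (\<exists>w. inj_on (\<lambda>(\<theta>\<^sub>1, \<theta>\<^sub>2). (\<theta>\<^sub>1 + \<theta>\<^sub>2, w \<theta>\<^sub>1 \<theta>\<^sub>2)) (\<Theta> \<times> \<Theta>) \<and>
        (\<forall>\<theta>\<^sub>1\<in>\<Theta>. \<forall>\<theta>\<^sub>2\<in>\<Theta>.
           conditional_density (density \<nu> (p \<theta>\<^sub>1) \<Otimes>\<^sub>M density \<nu> (p \<theta>\<^sub>2)) \<kappa>
             (\<lambda>(x\<^sub>1, x\<^sub>2). x\<^sub>1 + x\<^sub>2) (\<lambda>(x\<^sub>1, x\<^sub>2). x\<^sub>1) (q (w \<theta>\<^sub>1 \<theta>\<^sub>2)) \<and>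
           (AE (x\<^sub>1, x\<^sub>2) in \<nu> \<Otimes>\<^sub>M \<nu>.
              p \<theta>\<^sub>1 x\<^sub>1 * p \<theta>\<^sub>2 x\<^sub>2 = p (\<theta>\<^sub>1 + \<theta>\<^sub>2) (x\<^sub>1 + x\<^sub>2) * q (w \<theta>\<^sub>1 \<theta>\<^sub>2) (x\<^sub>1 + x\<^sub>2) x\<^sub>1)))"

end

theory Submission
  imports Defs
begin

text \<open>For a parent \<open>I\<close> with children \<open>L\<close>, \<open>R\<close> put \<open>\<omega>\<^sub>I = w \<theta>\<^sub>L \<theta>\<^sub>R\<close>. The cut property applied to
  \<open>(X\<^sub>L, X\<^sub>R)\<close> exchanges \<open>p(X\<^sub>L | \<theta>\<^sub>L) p(X\<^sub>R | \<theta>\<^sub>R)\<close> for \<open>p(X\<^sub>I | \<theta>\<^sub>I) q(X\<^sub>L | X\<^sub>I, \<omega>\<^sub>I)\<close>, so the product of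
  the densities over the current partition telescopes back to the root; in the other direction,
  \<open>(\<theta>\<^sub>I, \<omega>\<^sub>I)\<close> determines \<open>(\<theta>\<^sub>L, \<theta>\<^sub>R)\<close>, so the parameters are recovered from the root downwards. The cut
  identity holds only almost everywhere for \<open>\<nu> \<Otimes> \<nu>\<close>; it can be pulled back along
  \<open>x \<mapsto> (x\<^sub>L, x\<^sub>R)\<close> because the disintegration \<open>\<kappa>\<close> forces the image of \<open>\<nu> \<Otimes> \<nu>\<close> under addition to be
  absolutely continuous with respect to \<open>\<nu>\<close>.\<close>

section \<open>The tree of splits\<close>

abbreviation grid_interval :: "nat \<Rightarrow> nat \<Rightarrow> nat \<Rightarrow> real set" where
  "grid_interval N a b \<equiv> {real a / real N ..< real b / real N}"

text \<open>\<open>P\<close> is the current partition and \<open>T\<close> the set of triples (parent, left child, right child)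
  of all splits made so far.\<close>

inductive recursive_splitting ::
    "nat \<Rightarrow> real set set \<Rightarrow> (real set \<times> real set \<times> real set) set \<Rightarrow> bool" for N where
  root: "recursive_splitting N {{0..<1}} {}"
| split: "recursive_splitting N P T \<Longrightarrow> refines_at N P I L R P' \<Longrightarrow>
    recursive_splitting N P' (insert (I, L, R) T)"

text \<open>Form of \<open>splits_into\<close> with integer endpoints: index sets become integer
  ranges, and the strict inequalities make both children nonempty.\<close>

definition grid_split :: "nat \<Rightarrow> real set \<Rightarrow> real set \<Rightarrow> real set \<Rightarrow> bool" where
  "grid_split N I L R \<longleftrightarrow> (\<exists>a k b. a < k \<and> k < b \<and> b \<le> N \<and>
     I = grid_interval N a b \<and> L = grid_interval N a k \<and> R = grid_interval N k b)"

lemma grid_splitD: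
  assumes "grid_split N I L R" "N > 0"
  shows "L \<union> R = I" "L \<inter> R = {}" "L \<noteq> {}" "R \<noteq> {}" "R = I - L" "\<not> I \<subseteq> L" "\<not> I \<subseteq> R"
proof -
  obtain a k b where *: "a < k" "k < b" "b \<le> N" "I = grid_interval N a b"
    "L = grid_interval N a k" "R = grid_interval N k b"
    using assms(1) by (auto simp: grid_split_def)
  have lt: "real a / real N < real k / real N" "real k / real N < real b / real N"
    using * assms(2) by (auto simp: divide_strict_right_mono)
  show 1: "L \<union> R = I" and 2: "L \<inter> R = {}" using lt by (auto simp: *)
  show 3: "L \<noteq> {}" and 4: "R \<noteq> {}" using lt by (auto simp: *)
  show "R = I - L" "\<not> I \<subseteq> L" "\<not> I \<subseteq> R" using 1 2 3 4 by auto
qed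

lemma idx_grid_interval:
  assumes "N > 0" "b \<le> N" shows "idx N (grid_interval N a b) = {a..<b}"
  using assms by (auto simp: idx_def divide_le_cancel divide_less_cancel)

lemma idx_unit: "N > 0 \<Longrightarrow> idx N {0..<1} = {..<N}"
  by (auto simp: idx_def)

lemma splits_into_grid:
  assumes "splits_into N (grid_interval N a b) L R" "N > 0" "b \<le> N"
  shows "grid_split N (grid_interval N a b) L R"
proof -
  obtain k where k: "real k / real N \<in> interior (grid_interval N a b)"
    "L = grid_interval N a b \<inter> {..<real k / real N}" "R = grid_interval N a b \<inter> {real k / real N..}"
    using assms(1) by (auto simp: splits_into_def)
  then have lt: "real a / real N < real k / real N" "real k / real N < real b / real N"
    by (auto simp: interior_atLeastLessThan)
  then have "a < k" "k < b" using assms(2) by (auto simp: divide_less_cancel)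
  moreover have "L = grid_interval N a k" "R = grid_interval N k b" using k lt by auto
  ultimately show ?thesis using assms(3) by (auto simp: grid_split_def)
qed

text \<open>The clauses need one another in the induction. The key one is laminarity: a current
  interval lies inside or outside every interval split before. A child is a nonempty proper part of
  its parent, so by laminarity it cannot have been split already; hence no former parent reappears
  in the partition, and each interval is split at most once.\<close>

lemma recursive_splitting_invariants:
  assumes "recursive_splitting N P T" "N > 0"
  shows "finite P \<and> finite T \<and> disjoint P \<and>
    (\<forall>K\<in>P. \<exists>a b. a < b \<and> b \<le> N \<and> K = grid_interval N a b) \<and>
    (\<forall>(I, L, R)\<in>T. grid_split N I L R \<and> (\<forall>K\<in>P. K \<subseteq> I \<or> K \<inter> I = {})) \<and>
    fst ` T \<inter> P = {} \<and> inj_on fst T \<and>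
    {0..<1} \<in> P \<union> fst ` T \<and> (\<forall>(I, L, R)\<in>T. L \<in> P \<union> fst ` T \<and> R \<in> P \<union> fst ` T)"
  using assms(1)
proof induction
  case root
  have "{0..<1} = grid_interval N 0 N" using assms(2) by auto
  then have "\<exists>a b. a < b \<and> b \<le> N \<and> {0..<1} = grid_interval N a b"
    using assms(2) by (intro exI[of _ 0] exI[of _ N]) auto
  then show ?case by auto
next
  case (split P T I L R P')
  note conj = split.IH[THEN conjunct2]
  note fin = split.IH[THEN conjunct1] conj[THEN conjunct1]
  note conj = conj[THEN conjunct2]
  note dP = conj[THEN conjunct1]
  note conj = conj[THEN conjunct2]
  note gridP = conj[THEN conjunct1]
  note conj = conj[THEN conjunct2]
  note lam = conj[THEN conjunct1]
  note conj = conj[THEN conjunct2]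
  note disjT = conj[THEN conjunct1]
  note conj = conj[THEN conjunct2]
  note injT = conj[THEN conjunct1]
  note rootT = conj[THEN conjunct2]
  have I: "I \<in> P" and sp: "splits_into N I L R" and P': "P' = P - {I} \<union> {L, R}"
    using split.hyps by (auto simp: refines_at_def)
  have g: "grid_split N I L R"
  proof -
    have "\<exists>a b. a < b \<and> b \<le> N \<and> I = grid_interval N a b" by (rule bspec[OF gridP I])
    then obtain a b where "b \<le> N" "I = grid_interval N a b" by blast
    then show ?thesis using splits_into_grid[OF _ assms(2)] sp by simp
  qed
  note d = grid_splitD[OF g assms(2)]
  have disj: "K \<inter> I = {}" if "K \<in> P" "K \<noteq> I" for K
    using dP I that by (auto simp: disjoint_def)
  have newT: "K \<notin> fst ` T" if "K \<subseteq> I" "K \<noteq> {}" "\<not> I \<subseteq> K" for K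
  proof
    assume "K \<in> fst ` T"
    then have "I \<subseteq> K \<or> I \<inter> K = {}" using lam I by force
    then show False using that by blast
  qed
  have sub: "L \<subseteq> I" "R \<subseteq> I" using d(1) by auto
  have LT: "L \<notin> fst ` T" and RT: "R \<notin> fst ` T"
    using newT[OF sub(1) d(3,6)] newT[OF sub(2) d(4,7)] .
  have IT: "I \<notin> fst ` T" using disjT I by auto
  have grid: "\<forall>K\<in>P'. \<exists>a b. a < b \<and> b \<le> N \<and> K = grid_interval N a b"
  proof -
    obtain a k b where *: "a < k" "k < b" "b \<le> N" "L = grid_interval N a k" "R = grid_interval N k b"
      using g by (auto simp: grid_split_def)
    then have "k \<le> N" by simp
    then have "\<exists>a b. a < b \<and> b \<le> N \<and> L = grid_interval N a b"
         "\<exists>a b. a < b \<and> b \<le> N \<and> R = grid_interval N a b"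
      using * by blast+
    then show ?thesis using gridP P' by blast
  qed
  have "disjoint P'"
    unfolding disjoint_def
  proof (intro ballI impI)
    fix A B assume AB: "A \<in> P'" "B \<in> P'" "A \<noteq> B"
    have 1: "K \<inter> L = {} \<and> K \<inter> R = {}" if "K \<in> P" "K \<noteq> I" for K
      using disj[OF that] sub by blast
    have 2: "A \<inter> B = {}" if "A \<in> P" "B \<in> P" using dP that AB(3) by (auto simp: disjoint_def)
    show "A \<inter> B = {}" using AB 1 2 d(2) unfolding P' by blast
  qed
  moreover have "\<forall>(I', L', R')\<in>insert (I, L, R) T. grid_split N I' L' R' \<and> (\<forall>K\<in>P'. K \<subseteq> I' \<or> K \<inter> I' = {})"
  proof -
    have "K \<subseteq> I \<or> K \<inter> I = {}" if "K \<in> P'" for K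
      using that disj sub unfolding P' by blast
    moreover have "K \<subseteq> I' \<or> K \<inter> I' = {}" if "K \<in> P'" "(I', L', R') \<in> T" for K I' L' R'
    proof -
      have *: "\<forall>K\<in>P. K \<subseteq> I' \<or> K \<inter> I' = {}" using lam that(2) by blast
      then have "I \<subseteq> I' \<or> I \<inter> I' = {}" using I by (rule bspec)
      then have "L \<subseteq> I' \<or> L \<inter> I' = {}" "R \<subseteq> I' \<or> R \<inter> I' = {}" using sub by auto
      moreover have "K \<in> P \<or> K = L \<or> K = R" using that(1) unfolding P' by blast
      moreover have "K \<subseteq> I' \<or> K \<inter> I' = {}" if "K \<in> P" using * that by (rule bspec)
      ultimately show ?thesis by metis
    qed
    moreover have "grid_split N I' L' R'" if "(I', L', R') \<in> T" for I' L' R'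
      using bspec[OF lam that] by simp
    ultimately show ?thesis using g by blast
  qed
  moreover have "fst ` insert (I, L, R) T \<inter> P' = {}"
    using disjT LT RT d(6,7) unfolding P' by auto
  moreover have "inj_on fst (insert (I, L, R) T)"
    using injT IT by auto
  moreover have "finite P'" "finite (insert (I, L, R) T)" using fin P' by auto
  moreover have "{0..<1} \<in> P' \<union> fst ` insert (I, L, R) T \<and>
     (\<forall>(I', L', R')\<in>insert (I, L, R) T. L' \<in> P' \<union> fst ` insert (I, L, R) T \<and> R' \<in> P' \<union> fst ` insert (I, L, R) T)"
  proof -
    \<comment> \<open>The parent only moves from the partition to the set of parents, so the
      collection of all intervals gains just the two children.\<close>
    have eq: "P' \<union> fst ` insert (I, L, R) T = {L, R} \<union> (P \<union> fst ` T)" using I unfolding P' by auto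
    show ?thesis unfolding eq using rootT by blast
  qed
  ultimately show ?case using grid by (intro conjI) simp_all
qed

lemma recursive_splittingD:
  assumes "recursive_splitting N P T" "N > 0"
  shows "finite P" "finite T" "disjoint P" "inj_on fst T" "fst ` T \<inter> P = {}"
    "{0..<1} \<in> P \<union> fst ` T"
    and "\<And>I L R. (I, L, R) \<in> T \<Longrightarrow> grid_split N I L R"
    and "\<And>I L R. (I, L, R) \<in> T \<Longrightarrow> L \<in> P \<union> fst ` T \<and> R \<in> P \<union> fst ` T"
  subgoal using recursive_splitting_invariants[OF assms] by (elim conjE)
  subgoal using recursive_splitting_invariants[OF assms] by (elim conjE)
  subgoal using recursive_splitting_invariants[OF assms] by (elim conjE)
  subgoal using recursive_splitting_invariants[OF assms] by (elim conjE)
  subgoal using recursive_splitting_invariants[OF assms] by (elim conjE)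
  subgoal using recursive_splitting_invariants[OF assms] by (elim conjE)
  subgoal using recursive_splitting_invariants[OF assms] by (elim conjE) (drule (1) bspec, simp)
  subgoal using recursive_splitting_invariants[OF assms] by (elim conjE) (drule (1) bspec, simp)
  done

text \<open>Telescoping: a split trades the factor \<open>f I\<close> for \<open>f L * f R\<close>,
  that is, it contributes one extra factor \<open>g I\<close>. It is used pointwise, with
  \<open>f\<close> the densities of aggregates and \<open>g\<close> the conditional
  densities.\<close>

lemma recursive_splitting_prod:
  fixes f :: "real set \<Rightarrow> 'b::comm_monoid_mult"
  assumes "recursive_splitting N P T" "N > 0"
    and "\<And>I L R. (I, L, R) \<in> T \<Longrightarrow> f L * f R = f I * g I"
  shows "prod f P = f {0..<1} * prod g (fst ` T)"
  using assms(1,3)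
proof induction
  case (split P T I L R P')
  note inv = recursive_splittingD[OF split.hyps(1) assms(2)]
  have inv': "recursive_splitting N P' (insert (I, L, R) T)" using split.hyps by (rule recursive_splitting.split)
  have I: "I \<in> P" and P': "P' = P - {I} \<union> {L, R}"
    using split.hyps by (auto simp: refines_at_def)
  have d: "grid_split N I L R"
    using recursive_splittingD(7)[OF inv' assms(2)] by blast
  have disj: "K \<inter> I = {}" if "K \<in> P" "K \<noteq> I" for K
    using inv(3) I that by (auto simp: disjoint_def)
  note d = grid_splitD[OF d assms(2)]
  \<comment> \<open>The product runs over a set, so the children must be distinct from each other
    and from the surviving intervals to count as two new factors.\<close>
  have LR: "L \<notin> P - {I}" "R \<notin> P - {I}" "L \<noteq> R"
    using disj[of L] disj[of R] d(1-4) by auto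
  have fin: "finite P" "finite T" using inv(1,2) .
  have "prod f P' = f L * f R * prod f (P - {I})"
    using LR fin by (simp add: P' mult.assoc)
  also have "\<dots> = g I * (f I * prod f (P - {I}))"
    using split.prems[of I L R] by (simp add: ac_simps)
  also have "f I * prod f (P - {I}) = prod f P" using I fin by (simp add: prod.remove)
  also have "\<dots> = f {0..<1} * prod g (fst ` T)" using split by auto
  finally show ?case using fin inv(5) I by (subst image_insert, subst prod.insert) (auto simp: ac_simps)
qed auto

text \<open>Agreement spreads from the root down to the leaves. With \<open>f\<close> and
  \<open>f'\<close> the aggregates of two parameter vectors, this recovers the parameters of the
  cells from the new ones.\<close>

lemma recursive_splitting_determined:
  assumes "recursive_splitting N P T"
    and "f {0..<1} = f' {0..<1}"
    and "\<And>I L R. (I, L, R) \<in> T \<Longrightarrow> f I = f' I \<Longrightarrow> f L = f' L \<and> f R = f' R"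
  shows "\<forall>K\<in>P. f K = f' K"
  using assms(1,3)
proof induction
  case root
  then show ?case using assms(2) by simp
next
  case (split P T I L R P')
  then have *: "\<forall>K\<in>P. f K = f' K" by blast
  moreover have "I \<in> P" "P' = P - {I} \<union> {L, R}" using split.hyps(2) by (auto simp: refines_at_def)
  ultimately show ?case using split.prems[of I L R] by blast
qed

section \<open>From the list of partitions to the set of splits\<close>

lemma children_snoc:
  assumes "Ps \<noteq> []"
  shows "children N (Ps @ [P]) I L R \<longleftrightarrow> children N Ps I L R \<or> refines_at N (last Ps) I L R P"
proof -
  obtain n where n: "length Ps = Suc n" using assms by (cases Ps) auto
  have nth: "(Ps @ [P]) ! j = Ps ! j" if "j \<le> n" for j using that n by (simp add: nth_append)
  have lst: "(Ps @ [P]) ! Suc n = P" "last Ps = Ps ! n"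
    using n assms by (simp_all add: nth_append last_conv_nth)
  have "children N (Ps @ [P]) I L R \<longleftrightarrow>
      (\<exists>j<n. refines_at N ((Ps @ [P]) ! j) I L R ((Ps @ [P]) ! Suc j)) \<or>
      refines_at N ((Ps @ [P]) ! n) I L R ((Ps @ [P]) ! Suc n)"
    unfolding children_def length_append n by (simp del: nth_append_length) (metis less_Suc_eq)
  also have "(\<exists>j<n. refines_at N ((Ps @ [P]) ! j) I L R ((Ps @ [P]) ! Suc j)) \<longleftrightarrow> children N Ps I L R"
    unfolding children_def n by (auto simp: nth Suc_le_eq simp del: nth_append_length)
  finally show ?thesis using nth[of n] lst by simp
qed

text \<open>A refinement step can be read off from the two partitions: the parent is the only
  interval that disappears, and the children are the ones that appear. This is what makes
  \<open>children\<close> contribute exactly one triple per step.\<close>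

lemma refines_at_unique:
  assumes "refines_at N P I L R P'" "refines_at N P I' L' R' P'"
    and "recursive_splitting N P T" "N > 0"
  shows "I' = I \<and> L' = L \<and> R' = R"
proof -
  note inv1 = recursive_splittingD[OF recursive_splitting.split[OF assms(3,1)] assms(4)]
  note inv2 = recursive_splittingD[OF recursive_splitting.split[OF assms(3,2)] assms(4)]
  have I: "I \<in> P" "P' = P - {I} \<union> {L, R}" and I': "I' \<in> P" "P' = P - {I'} \<union> {L', R'}"
    using assms by (auto simp: refines_at_def)
  have "I \<notin> P'" "I' \<notin> P'" using inv1(5) inv2(5) by auto
  then have eq: "I' = I" using I I' by blast
  have g: "grid_split N I L R" "grid_split N I L' R'" using inv1(7) inv2(7) eq by auto
  have "disjoint P" using recursive_splittingD(3)[OF assms(3,4)] .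
  then have disj: "K \<inter> I = {}" if "K \<in> P" "K \<noteq> I" for K using I that by (auto simp: disjoint_def)
  note d = grid_splitD[OF g(1) assms(4)] and d' = grid_splitD[OF g(2) assms(4)]
  have new: "K \<notin> P" if "K \<subseteq> I" "K \<noteq> {}" "\<not> I \<subseteq> K" for K
    using disj[of K] that by blast
  have "L \<notin> P" using d by (intro new) auto
  moreover have "P - {I} \<union> {L, R} = P - {I} \<union> {L', R'}" using I(2) I'(2) eq by simp
  ultimately have "L \<in> {L', R'}" by blast
  \<comment> \<open>Left and right are told apart by the left endpoint of the parent:
    \<open>L\<close> contains it, while \<open>R'\<close> starts strictly after it.\<close>
  moreover have "L \<noteq> R'"
  proof
    obtain a k b where *: "a < k" "k < b" "I = grid_interval N a b" "L = grid_interval N a k"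
      using g(1) by (auto simp: grid_split_def)
    obtain a' k' b' where **: "a' < k'" "k' < b'" "I = grid_interval N a' b'" "R' = grid_interval N k' b'"
      using g(2) by (auto simp: grid_split_def)
    have lt: "real x / real N < real y / real N" if "x < y" for x y
      using that assms(4) by (simp add: divide_strict_right_mono)
    have aI: "real a / real N \<in> I" "real a / real N \<in> L" using *  lt[of a k] lt[of k b] by auto
    have "real a' / real N \<in> I" using ** lt[of a' k'] lt[of k' b'] by auto
    then have "real a / real N \<le> real a' / real N" using * by auto
    then have "real a / real N \<notin> R'" using ** lt[of a' k'] by auto
    then show "L = R' \<Longrightarrow> False" using aI by blast
  qed
  ultimately have "L = L'" by auto
  then show ?thesis using eq d(5) d'(5) by auto
qed

text \<open>Induction from the end of the list, since appending a partition is one application of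
  the rule \<open>split\<close>. A step removes only the parent, so every interval that ever occurs
  is either still present at the end or has been split.\<close>

lemma recursive_splitting_children:
  assumes "Ps \<noteq> []" "hd Ps = {{0..<1}}" "N > 0"
    and "successively (\<lambda>P P'. \<exists>I L R. refines_at N P I L R P') Ps"
  shows "recursive_splitting N (last Ps) {(I, L, R). children N Ps I L R} \<and>
    intervals Ps = last Ps \<union> fst ` {(I, L, R). children N Ps I L R}"
  using assms
proof (induction Ps rule: rev_induct)
  case (snoc P' Ps)
  show ?case
  proof (cases "Ps = []")
    case True
    then have "{(I, L, R). children N (Ps @ [P']) I L R} = {}"
      by (auto simp: children_def)
    then show ?thesis using True snoc.prems by (auto simp: intervals_def intro: recursive_splitting.root)
  next
    case False
    let ?T = "{(I, L, R). children N Ps I L R}"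
    have IH: "recursive_splitting N (last Ps) ?T" "intervals Ps = last Ps \<union> fst ` ?T"
      using snoc False by (auto simp: successively_append_iff)
    obtain I L R where ref: "refines_at N (last Ps) I L R P'"
      using snoc.prems False by (auto simp: successively_append_iff)
    have T: "{(I, L, R). children N (Ps @ [P']) I L R} = insert (I, L, R) ?T"
    proof -
      have "refines_at N (last Ps) I' L' R' P' \<longleftrightarrow> (I', L', R') = (I, L, R)" for I' L' R'
        using ref refines_at_unique[OF ref _ IH(1) \<open>N > 0\<close>, of I' L' R'] by blast
      then show ?thesis unfolding children_snoc[OF False] by blast
    qed
    have "intervals (Ps @ [P']) = P' \<union> intervals Ps" by (auto simp: intervals_def)
    also have "\<dots> = P' \<union> fst ` insert (I, L, R) ?T"
      using ref unfolding IH(2) by (auto simp: refines_at_def)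
    finally show ?thesis
      unfolding T using recursive_splitting.split[OF IH(1) ref] by simp
  qed
qed simp

section \<open>Null sets and partial sums of coordinates\<close>

text \<open>Testing on null sets avoids any measurability requirement on \<open>R\<close>: its
  exceptional set is enlarged to a measurable null set, and only that set is pulled back.\<close>

lemma AE_pullback:
  assumes "\<And>A. A \<in> null_sets N \<Longrightarrow> AE x in M. T x \<notin> A"
    and "AE y in N. R y" and "\<And>x. x \<in> space M \<Longrightarrow> T x \<in> space N"
  shows "AE x in M. R (T x)"
proof -
  obtain A where A: "A \<in> null_sets N" "{y \<in> space N. \<not> R y} \<subseteq> A"
    using assms(2) by (auto simp: eventually_ae_filter)
  show ?thesis using assms(1)[OF A(1)] AE_space
    by eventually_elim (use A(2) assms(3) in auto)
qed

text \<open>The product over \<open>I \<union> J\<close> is the image under \<open>merge\<close> of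
  the product of the two partial products, so this is the Fubini direction from iterated to joint
  almost-everywhere statements; that direction is where measurability of \<open>Q\<close>
  enters.\<close>

lemma AE_PiM_merge:
  fixes I J :: "'i set"
  assumes "sigma_finite_measure \<nu>" and "finite I" "finite J" "I \<inter> J = {}"
    and meas: "{z \<in> space (PiM (I \<union> J) (\<lambda>_. \<nu>)). Q z} \<in> sets (PiM (I \<union> J) (\<lambda>_. \<nu>))"
    and AE: "AE x in PiM I (\<lambda>_. \<nu>). AE y in PiM J (\<lambda>_. \<nu>). Q (merge I J (x, y))"
  shows "AE z in PiM (I \<union> J) (\<lambda>_. \<nu>). Q z"
proof -
  interpret sigma_finite_measure \<nu> by fact
  interpret product_sigma_finite "\<lambda>_::'i. \<nu>" by standard
  interpret A: sigma_finite_measure "PiM I (\<lambda>_. \<nu>)" by (rule sigma_finite) fact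
  interpret B: sigma_finite_measure "PiM J (\<lambda>_. \<nu>)" by (rule sigma_finite) fact
  interpret AB: pair_sigma_finite "PiM I (\<lambda>_. \<nu>)" "PiM J (\<lambda>_. \<nu>)" ..
  have m: "merge I J \<in> PiM I (\<lambda>_. \<nu>) \<Otimes>\<^sub>M PiM J (\<lambda>_. \<nu>) \<rightarrow>\<^sub>M PiM (I \<union> J) (\<lambda>_. \<nu>)"
    by (rule measurable_merge)
  have "{z \<in> space (PiM I (\<lambda>_. \<nu>) \<Otimes>\<^sub>M PiM J (\<lambda>_. \<nu>)). Q (merge I J z)} =
      merge I J -` {z \<in> space (PiM (I \<union> J) (\<lambda>_. \<nu>)). Q z} \<inter> space (PiM I (\<lambda>_. \<nu>) \<Otimes>\<^sub>M PiM J (\<lambda>_. \<nu>))"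
    using measurable_space[OF m] by auto
  then have "{z \<in> space (PiM I (\<lambda>_. \<nu>) \<Otimes>\<^sub>M PiM J (\<lambda>_. \<nu>)). Q (merge I J z)} \<in> sets (PiM I (\<lambda>_. \<nu>) \<Otimes>\<^sub>M PiM J (\<lambda>_. \<nu>))"
    using measurable_sets[OF m meas] by simp
  then have "AE z in PiM I (\<lambda>_. \<nu>) \<Otimes>\<^sub>M PiM J (\<lambda>_. \<nu>). Q (merge I J z)"
    using AE by (rule AB.AE_pair_measure)
  then have "AE z in distr (PiM I (\<lambda>_. \<nu>) \<Otimes>\<^sub>M PiM J (\<lambda>_. \<nu>)) (PiM (I \<union> J) (\<lambda>_. \<nu>)) (merge I J). Q z"
    using m meas by (subst AE_distr_iff) auto
  then show ?thesis unfolding distr_merge[OF \<open>I \<inter> J = {}\<close> \<open>finite I\<close> \<open>finite J\<close>] .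
qed

lemma AE_PiM_singleton:
  fixes i :: 'i
  assumes "sigma_finite_measure \<nu>" "AE t in \<nu>. R t"
  shows "AE x in PiM {i} (\<lambda>_. \<nu>). R (x i)"
proof -
  interpret sigma_finite_measure \<nu> by fact
  interpret product_sigma_finite "\<lambda>_::'i. \<nu>" by standard
  have "AE t in distr (PiM {i} (\<lambda>_. \<nu>)) \<nu> (\<lambda>x. x i). R t"
    using assms(2) unfolding distr_singleton .
  then show ?thesis by (rule AE_distrD[rotated]) simp
qed

lemma dominating_measuresD:
  assumes "dominating_measures \<nu> \<kappa>"
  shows "sigma_finite_measure \<nu>" "sets \<nu> = sets borel" "space \<nu> = UNIV"
  using assms sets_eq_imp_space_eq[of \<nu> borel] by (auto simp: dominating_measures_def)

text \<open>The disintegration identity is applied to the indicator of a null set in the sum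
  coordinate alone; vanishing of the resulting double integral is then unwound one variable at a
  time.\<close>

lemma AE_AE_plus:
  assumes dom: "dominating_measures \<nu> \<kappa>" and R: "AE s in \<nu>. R s"
  shows "AE x in \<nu>. AE y in \<nu>. R (x + y)"
proof -
  note [simp] = dominating_measuresD[OF dom]
  note [measurable_cong] = dominating_measuresD(2)[OF dom]
  interpret sigma_finite_measure \<nu> by simp
  obtain A where A: "A \<in> null_sets \<nu>" "{y \<in> space \<nu>. \<not> R y} \<subseteq> A"
    using R by (auto simp: eventually_ae_filter)
  then have [measurable]: "A \<in> sets borel" by auto
  let ?f = "\<lambda>(s, y). indicator A s :: ennreal"
  have "?f \<in> borel_measurable (borel \<Otimes>\<^sub>M (borel :: real measure))" by measurable
  then have "(\<integral>\<^sup>+ x. (\<integral>\<^sup>+ y. ?f (x + y, x) \<partial>\<nu>) \<partial>\<nu>) = (\<integral>\<^sup>+ s. (\<integral>\<^sup>+ y. ?f (s, y) \<partial>\<kappa> s) \<partial>\<nu>)"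
    using dom unfolding dominating_measures_def by blast
  \<comment> \<open>For \<open>s\<close> outside \<open>A\<close> the inner integrand is identically
    zero, so the size of \<open>\<kappa> s\<close> does not matter.\<close>
  also have "\<dots> = (\<integral>\<^sup>+ s. 0 \<partial>\<nu>)"
    by (rule nn_integral_cong_AE, use AE_not_in[OF A(1)] in eventually_elim) auto
  finally have "(\<integral>\<^sup>+ x. (\<integral>\<^sup>+ y. indicator A (x + y) \<partial>\<nu>) \<partial>\<nu>) = 0" by simp
  then have "AE x in \<nu>. (\<integral>\<^sup>+ y. indicator A (x + y) \<partial>\<nu>) = 0"
    by (subst (asm) nn_integral_0_iff_AE) auto
  then show ?thesis
  proof eventually_elim
    case (elim x)
    then have "AE y in \<nu>. indicator A (x + y) = (0 :: ennreal)"
      by (subst (asm) nn_integral_0_iff_AE) auto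
    then show ?case by eventually_elim (use A(2) in \<open>auto simp: indicator_def split: if_splits\<close>)
  qed
qed

text \<open>Coordinates are added one at a time by \<open>AE_AE_plus\<close>. The base case is a
  singleton because an empty sum is the constant 0, where \<open>R\<close> may fail.\<close>

lemma AE_PiM_sum_full:
  assumes dom: "dominating_measures \<nu> \<kappa>" and "finite J" "J \<noteq> {}" and "AE s in \<nu>. R s"
  shows "AE x in PiM J (\<lambda>_. \<nu>). R (sum x J)"
  using assms(2-4)
proof (induction J arbitrary: R rule: finite_ne_induct)
  case (singleton i)
  then show ?case using AE_PiM_singleton[OF dominating_measuresD(1)[OF dom], of R i] by simp
next
  case (insert i J)
  note [simp] = dominating_measuresD[OF dom]
  note [measurable_cong] = dominating_measuresD(2)[OF dom]
  have "AE x in PiM (J \<union> {i}) (\<lambda>_. \<nu>). R (sum x (insert i J))"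
  proof (rule AE_pullback[where N = \<nu> and R = R])
    fix A assume A: "A \<in> null_sets \<nu>"
    then have [measurable]: "A \<in> sets borel" by auto
    show "AE x in PiM (J \<union> {i}) (\<lambda>_. \<nu>). sum x (insert i J) \<notin> A"
    proof (rule AE_PiM_merge)
      have "(\<lambda>x. sum x (insert i J)) \<in> PiM (J \<union> {i}) (\<lambda>_. \<nu>) \<rightarrow>\<^sub>M borel"
        by (rule borel_measurable_sum) (auto intro!: measurable_component_singleton[THEN measurable_compose])
      then show "{z \<in> space (PiM (J \<union> {i}) (\<lambda>_. \<nu>)). sum z (insert i J) \<notin> A} \<in> sets (PiM (J \<union> {i}) (\<lambda>_. \<nu>))"
        by measurable
      \<comment> \<open>The induction hypothesis is used for the predicate that \<open>s + t\<close>
        avoids \<open>A\<close> for almost every \<open>t\<close>, which is why \<open>R\<close> is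
        kept arbitrary.\<close>
      have "AE x in PiM J (\<lambda>_. \<nu>). AE t in \<nu>. sum x J + t \<notin> A"
        using insert.IH[OF AE_AE_plus[OF dom AE_not_in[OF A]]] .
      then show "AE x in PiM J (\<lambda>_. \<nu>). AE y in PiM {i} (\<lambda>_. \<nu>). sum (merge J {i} (x, y)) (insert i J) \<notin> A"
      proof eventually_elim
        case (elim x)
        have "AE y in PiM {i} (\<lambda>_. \<nu>). sum x J + y i \<notin> A"
          by (rule AE_PiM_singleton) (use elim in auto)
        moreover have "sum (merge J {i} (x, y)) (insert i J) = sum x J + y i" for y
          using insert.hyps by (simp add: merge_def cong: sum.cong)
        ultimately show ?case by simp
      qed
    qed (use insert.hyps in auto)
  qed (use insert in auto)
  then show ?case unfolding Un_insert_right Un_empty_right .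
qed

text \<open>The joint statement is unfolded into an iterated one, the full-sum lemma is applied to
  each block in turn, and the blocks are merged. This transports the cut identity from two variables
  to the whole data vector.\<close>

lemma AE_PiM_sum_pair:
  assumes dom: "dominating_measures \<nu> \<kappa>" and "finite F"
    and J: "J \<subseteq> F" "J \<noteq> {}" and K: "K \<subseteq> F" "K \<noteq> {}" and JK: "J \<inter> K = {}"
    and R: "AE z in \<nu> \<Otimes>\<^sub>M \<nu>. R z"
  shows "AE x in PiM F (\<lambda>_. \<nu>). R (sum x J, sum x K)"
proof (rule AE_pullback[where N = "\<nu> \<Otimes>\<^sub>M \<nu>" and R = R])
  note [simp] = dominating_measuresD[OF dom]
  note [measurable_cong] = dominating_measuresD(2)[OF dom]
  interpret sigma_finite_measure \<nu> by simp
  interpret pair_sigma_finite \<nu> \<nu> ..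
  have fin: "finite J" "finite K" using finite_subset[OF J(1) assms(2)] finite_subset[OF K(1) assms(2)] .
  fix A assume A: "A \<in> null_sets (\<nu> \<Otimes>\<^sub>M \<nu>)"
  then have A'[measurable]: "A \<in> sets (borel \<Otimes>\<^sub>M borel)"
    by (metis null_setsD2 sets_pair_measure_cong \<open>sets \<nu> = sets borel\<close>)
  have m: "{z \<in> space (PiM H (\<lambda>_. \<nu>)). (sum z J, sum z K) \<notin> A} \<in> sets (PiM H (\<lambda>_. \<nu>))"
    if "J \<union> K \<subseteq> H" for H
  proof -
    have [measurable]: "(\<lambda>x. sum x J) \<in> PiM H (\<lambda>_. \<nu>) \<rightarrow>\<^sub>M borel" "(\<lambda>x. sum x K) \<in> PiM H (\<lambda>_. \<nu>) \<rightarrow>\<^sub>M borel"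
      by (rule borel_measurable_sum, use that in \<open>auto intro!: measurable_component_singleton[THEN measurable_compose]\<close>)+
    show ?thesis by measurable
  qed
  have "AE s in \<nu>. AE t in \<nu>. (s, t) \<notin> A"
    by (rule AE_pair) (rule AE_not_in[OF A])
  from AE_PiM_sum_full[OF dom fin(1) J(2) this]
  have 1: "AE x in PiM J (\<lambda>_. \<nu>). AE y in PiM K (\<lambda>_. \<nu>). (sum x J, sum y K) \<notin> A"
    by eventually_elim (rule AE_PiM_sum_full[OF dom fin(2) K(2)])
  have 2: "AE x in PiM (J \<union> K) (\<lambda>_. \<nu>). (sum x J, sum x K) \<notin> A"
  proof (rule AE_PiM_merge)
    have "sum (merge J K (x, y)) J = sum x J" "sum (merge J K (x, y)) K = sum y K" for x y :: "'a \<Rightarrow> real"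
      using JK by (auto simp: merge_def intro!: sum.cong)
    then show "AE x in PiM J (\<lambda>_. \<nu>). AE y in PiM K (\<lambda>_. \<nu>).
        (sum (merge J K (x, y)) J, sum (merge J K (x, y)) K) \<notin> A"
      using 1 by simp
  qed (use fin JK m in auto)
  \<comment> \<open>The coordinates outside both blocks do not enter the two sums, so they are
    adjoined by one more merge.\<close>
  have F: "(J \<union> K) \<union> (F - (J \<union> K)) = F" using J K by auto
  have "AE x in PiM ((J \<union> K) \<union> (F - (J \<union> K))) (\<lambda>_. \<nu>). (sum x J, sum x K) \<notin> A"
  proof (rule AE_PiM_merge)
    have *: "sum (merge (J \<union> K) H (x, y)) J = sum x J" "sum (merge (J \<union> K) H (x, y)) K = sum x K" for x y :: "'a \<Rightarrow> real" and H
      by (auto simp: merge_def intro!: sum.cong)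
    show "AE x in PiM (J \<union> K) (\<lambda>_. \<nu>). AE y in PiM (F - (J \<union> K)) (\<lambda>_. \<nu>).
        (sum (merge (J \<union> K) (F - (J \<union> K)) (x, y)) J, sum (merge (J \<union> K) (F - (J \<union> K)) (x, y)) K) \<notin> A"
      using 2 by eventually_elim (simp add: *)
  qed (use fin \<open>finite F\<close> m in auto)
  then show "AE x in PiM F (\<lambda>_. \<nu>). (sum x J, sum x K) \<notin> A" unfolding F .
qed (use R dominating_measuresD[OF dom] in \<open>auto simp: space_pair_measure\<close>)

section \<open>Laws of aggregated components\<close>

lemma agg_restrict: "agg N I (restrict x (idx N I)) = agg N I x"
  by (simp add: agg_def)

lemma measurable_agg:
  assumes "\<And>i. i \<in> idx N I \<Longrightarrow> sets (M i) = sets borel"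
  shows "agg N I \<in> PiM (idx N I) M \<rightarrow>\<^sub>M borel"
  unfolding agg_def
proof (rule borel_measurable_sum)
  fix i assume i: "i \<in> idx N I"
  then show "(\<lambda>x. x i) \<in> borel_measurable (PiM (idx N I) M)"
    using measurable_component_singleton[OF i, of M] measurable_cong_sets[OF refl assms[OF i]] by blast
qed

text \<open>The defining identity depends only on the joint law of the two variables, so it can be
  pulled back by a change of variables.\<close>

lemma conditional_density_distr:
  assumes dom: "dominating_measures \<nu> \<kappa>" and T[measurable]: "T \<in> P \<rightarrow>\<^sub>M N"
    and cd: "conditional_density (distr P N T) \<kappa> S Y g"
  shows "conditional_density P \<kappa> (\<lambda>a. S (T a)) (\<lambda>a. Y (T a)) g"
proof -
  have [measurable]: "S \<in> borel_measurable N" "Y \<in> borel_measurable N"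
    and g[measurable]: "(\<lambda>(s, y). g s y) \<in> borel_measurable (borel \<Otimes>\<^sub>M borel)"
    using cd by (auto simp: conditional_density_def)
  have "emeasure P {a \<in> space P. S (T a) \<in> A \<and> Y (T a) \<in> B} =
      (\<integral>\<^sup>+ a. indicator A (S (T a)) * (\<integral>\<^sup>+ y. ennreal (g (S (T a)) y) * indicator B y \<partial>\<kappa> (S (T a))) \<partial>P)"
    if [measurable]: "A \<in> sets borel" "B \<in> sets borel" for A B
  proof -
    let ?f = "\<lambda>(s, y). ennreal (g s y) * indicator B y"
    have "?f \<in> borel_measurable (borel \<Otimes>\<^sub>M borel)"
      by measurable
    \<comment> \<open>Measurability in \<open>s\<close> of an integral against the varying measure
      \<open>\<kappa> s\<close> is the kernel part of \<open>dominating_measures\<close>; the change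
      of variables relies on it.\<close>
    then have "(\<lambda>s. \<integral>\<^sup>+ y. ?f (s, y) \<partial>\<kappa> s) \<in> borel_measurable borel"
      using dom unfolding dominating_measures_def by blast
    then have [measurable]: "(\<lambda>s. \<integral>\<^sup>+ y. ennreal (g s y) * indicator B y \<partial>\<kappa> s) \<in> borel_measurable borel"
      by simp
    have "{a \<in> space P. S (T a) \<in> A \<and> Y (T a) \<in> B} = T -` {z \<in> space N. S z \<in> A \<and> Y z \<in> B} \<inter> space P"
      using measurable_space[OF T] by auto
    then have "emeasure P {a \<in> space P. S (T a) \<in> A \<and> Y (T a) \<in> B}
        = emeasure (distr P N T) {z \<in> space (distr P N T). S z \<in> A \<and> Y z \<in> B}"
      by (simp add: emeasure_distr)
    also have "\<dots> = (\<integral>\<^sup>+ z. indicator A (S z) *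
          (\<integral>\<^sup>+ y. ennreal (g (S z) y) * indicator B y \<partial>\<kappa> (S z)) \<partial>distr P N T)"
      using cd that unfolding conditional_density_def by blast
    also have "\<dots> = (\<integral>\<^sup>+ a. indicator A (S (T a)) *
          (\<integral>\<^sup>+ y. ennreal (g (S (T a)) y) * indicator B y \<partial>\<kappa> (S (T a))) \<partial>P)"
      by (rule nn_integral_distr) measurable
    finally show ?thesis .
  qed
  then show ?thesis using cd by (auto simp: conditional_density_def)
qed

text \<open>Reproducibility speaks about a product of densities. By independence that product is the
  law of the block of variables indexed by \<open>idx N I\<close>, so the density of the sum carries
  over to the given probability space.\<close>

lemma distributed_agg:
  assumes "prob_space M" and sets_\<nu>: "sets \<nu> = sets borel"
    and indep: "prob_space.indep_vars M (\<lambda>_. borel) X {..<N}"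
    and X: "\<And>i. i < N \<Longrightarrow> distributed M \<nu> (X i) (f i)"
    and ne: "idx N I \<noteq> {}"
    and agg: "distributed (\<Pi>\<^sub>M i\<in>idx N I. density \<nu> (f i)) \<nu> (agg N I) h"
  shows "distributed M \<nu> (\<lambda>a. agg N I (\<lambda>i. X i a)) h"
proof -
  interpret prob_space M by fact
  note [measurable_cong] = sets_\<nu>
  let ?J = "idx N I"
  let ?X = "\<lambda>a. \<lambda>i\<in>?J. X i a"
  have J: "?J \<subseteq> {..<N}" by (auto simp: idx_def)
  have rv: "X i \<in> borel_measurable M" if "i \<in> ?J" for i
    using X[of i] J that sets_\<nu> by (auto simp: distributed_def cong: measurable_cong_sets)
  then have mX: "?X \<in> M \<rightarrow>\<^sub>M PiM ?J (\<lambda>_. borel)" by (rule measurable_restrict)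
  have ag: "agg N I \<in> PiM ?J (\<lambda>_. borel) \<rightarrow>\<^sub>M borel" by (rule measurable_agg) simp
  then have ag': "agg N I \<in> PiM ?J (\<lambda>_. borel) \<rightarrow>\<^sub>M \<nu>" using sets_\<nu> by (simp cong: measurable_cong_sets)
  have comp: "(\<lambda>a. agg N I (\<lambda>i. X i a)) = agg N I \<circ> ?X"
    by (auto simp: agg_restrict)
  have "distr M (PiM ?J (\<lambda>_. borel)) ?X = (\<Pi>\<^sub>M i\<in>?J. distr M borel (X i))"
    using indep_vars_iff_distr_eq_PiM'[OF ne rv] indep_vars_subset[OF indep J] by simp
  also have "\<dots> = (\<Pi>\<^sub>M i\<in>?J. density \<nu> (f i))"
  proof (rule PiM_cong)
    fix i assume i: "i \<in> ?J"
    have "distr M borel (X i) = distr M \<nu> (X i)" by (rule distr_cong) (simp_all add: sets_\<nu>)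
    also have "\<dots> = density \<nu> (f i)" using X[of i] i J by (auto simp: distributed_def)
    finally show "distr M borel (X i) = density \<nu> (f i)" .
  qed simp
  finally have eq: "distr M (PiM ?J (\<lambda>_. borel)) ?X = (\<Pi>\<^sub>M i\<in>?J. density \<nu> (f i))" .
  have "distr M \<nu> (\<lambda>a. agg N I (\<lambda>i. X i a)) = distr (\<Pi>\<^sub>M i\<in>?J. density \<nu> (f i)) \<nu> (agg N I)"
    unfolding comp eq[symmetric] by (rule distr_distr[symmetric, OF ag' mX])
  moreover have "(\<lambda>a. agg N I (\<lambda>i. X i a)) \<in> M \<rightarrow>\<^sub>M \<nu>"
    unfolding comp by (rule measurable_comp[OF mX ag'])
  ultimately show ?thesis using agg by (auto simp: distributed_def)
qed

text \<open>Functions of disjoint blocks of independent variables are independent, so the joint law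
  is the product measure that appears in \<open>sums_are_cuts\<close>.\<close>

lemma distr_agg_pair:
  assumes "prob_space M" and sets_\<nu>: "sets \<nu> = sets borel"
    and indep: "prob_space.indep_vars M (\<lambda>_. borel) X {..<N}"
    and disj: "idx N L \<inter> idx N R = {}"
    and L: "distributed M \<nu> (\<lambda>a. agg N L (\<lambda>i. X i a)) f"
    and R: "distributed M \<nu> (\<lambda>a. agg N R (\<lambda>i. X i a)) g"
  shows "distr M (\<nu> \<Otimes>\<^sub>M \<nu>) (\<lambda>a. (agg N L (\<lambda>i. X i a), agg N R (\<lambda>i. X i a))) = density \<nu> f \<Otimes>\<^sub>M density \<nu> g"
proof -
  interpret prob_space M by fact
  have ag: "agg N K \<in> PiM (idx N K) (\<lambda>_. borel) \<rightarrow>\<^sub>M \<nu>" for K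
    using measurable_agg[of N K "\<lambda>_. borel"] sets_\<nu> by (simp cong: measurable_cong_sets)
  have "indep_var \<nu> (agg N L \<circ> (\<lambda>a. \<lambda>i\<in>idx N L. X i a)) \<nu> (agg N R \<circ> (\<lambda>a. \<lambda>i\<in>idx N R. X i a))"
    by (rule indep_var_compose[OF indep_var_restrict[OF indep disj] ag ag]) (auto simp: idx_def)
  then have "indep_var \<nu> (\<lambda>a. agg N L (\<lambda>i. X i a)) \<nu> (\<lambda>a. agg N R (\<lambda>i. X i a))"
    by (simp add: comp_def agg_restrict)
  then show ?thesis
    using L R unfolding indep_var_distribution_eq by (simp add: distributed_def)
qed

lemma agg_split:
  assumes "grid_split N I L R" "N > 0"
  shows "agg N I x = agg N L x + agg N R x" "idx N L \<inter> idx N R = {}"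
    "idx N L \<noteq> {}" "idx N R \<noteq> {}"
proof -
  obtain a k b where *: "a < k" "k < b" "b \<le> N" "I = grid_interval N a b"
    "L = grid_interval N a k" "R = grid_interval N k b"
    using assms(1) by (auto simp: grid_split_def)
  then have i: "idx N I = {a..<b}" "idx N L = {a..<k}" "idx N R = {k..<b}"
    using assms(2) idx_grid_interval by auto
  show "agg N I x = agg N L x + agg N R x"
    using * unfolding agg_def i by (simp add: sum.atLeastLessThan_concat)
  show "idx N L \<inter> idx N R = {}" "idx N L \<noteq> {}" "idx N R \<noteq> {}" using * i by auto
qed

lemma agg_cell: "i < N \<Longrightarrow> agg N (cell N i) x = x i"
  using idx_grid_interval[of N "i + 1" i] by (simp add: agg_def cell_def)

lemma inj_on_cell: "inj_on (cell N) {..<N}"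
proof (rule inj_onI)
  fix i j assume "i \<in> {..<N}" "j \<in> {..<N}" "cell N i = cell N j"
  \<comment> \<open>The test vector \<open>real\<close> has entry \<open>real i\<close> at index
    \<open>i\<close>, so its aggregate over a cell reveals the index of the cell.\<close>
  then have "real i = real j"
    using agg_cell[of i N real] agg_cell[of j N real] by (simp only: lessThan_iff)
  then show "i = j" by simp
qed

section \<open>The factorization\<close>

text \<open>A bare product formula would leave its factors uninterpreted; hence the conclusion also
  identifies the root factor as a density and the other factors as conditional densities.
  Injectivity on \<open>D\<close> expresses that the new parameters reparameterize the old
  ones.\<close>

theorem theorem1:
  fixes N :: nat
    and Ps :: "real set set list"
    and \<nu> :: "real measure"
    and \<kappa> :: "real \<Rightarrow> real measure"
    and \<Theta> :: "real set"
    and p :: "real \<Rightarrow> real \<Rightarrow> real"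
    and q :: "'w \<Rightarrow> real \<Rightarrow> real \<Rightarrow> real"
    and D :: "(nat \<Rightarrow> real) set"
    and P :: "(nat \<Rightarrow> real) \<Rightarrow> 'a measure"
    and X :: "nat \<Rightarrow> 'a \<Rightarrow> real"
    and lik :: "(nat \<Rightarrow> real) \<Rightarrow> (nat \<Rightarrow> real) \<Rightarrow> real"
  assumes N_pos: "N > 0"
    and dominating: "dominating_measures \<nu> \<kappa>"
    and likelihood: "\<And>\<theta>. \<theta> \<in> D \<Longrightarrow> prob_space (P \<theta>) \<and>
          distributed (P \<theta>) (\<Pi>\<^sub>M i\<in>{..<N}. \<nu>) (\<lambda>a. \<lambda>i\<in>{..<N}. X i a) (lik \<theta>)"
    and cond_A: "complete_recursive_partition N Ps"
    and cond_B_indep: "\<And>\<theta>. \<theta> \<in> D \<Longrightarrow> prob_space.indep_vars (P \<theta>) (\<lambda>_. borel) X {..<N}"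
    and cond_B_L_indep: "L_independent N \<nu> p D lik"
    and cond_B_family: "density_family \<nu> \<Theta> p"
    and cond_B_members: "\<And>\<theta> i. \<theta> \<in> D \<Longrightarrow> i < N \<Longrightarrow>
          \<theta> i \<in> \<Theta> \<and> distributed (P \<theta>) \<nu> (X i) (p (\<theta> i))"
    and cond_C: "reproducible N Ps \<nu> \<Theta> p"
    and cond_D: "sums_are_cuts \<nu> \<kappa> \<Theta> p q"
  shows "\<exists>\<omega> :: real set \<Rightarrow> (nat \<Rightarrow> real) \<Rightarrow> 'w.
      inj_on (\<lambda>\<theta>. (agg N {0..<1} \<theta>, \<lambda>I\<in>nonterminal_intervals Ps. \<omega> I \<theta>)) D \<and>
      (\<forall>\<theta>\<in>D.
         distributed (P \<theta>) \<nu> (\<lambda>a. agg N {0..<1} (\<lambda>i. X i a)) (p (agg N {0..<1} \<theta>)) \<and>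
         (\<forall>I\<in>nonterminal_intervals Ps.
            conditional_density (P \<theta>) \<kappa>
              (\<lambda>a. agg N I (\<lambda>i. X i a)) (\<lambda>a. agg N (left_child N Ps I) (\<lambda>i. X i a)) (q (\<omega> I \<theta>))) \<and>
         (AE x in (\<Pi>\<^sub>M i\<in>{..<N}. \<nu>).
            lik \<theta> x = p (agg N {0..<1} \<theta>) (agg N {0..<1} x) *
              (\<Prod>I\<in>nonterminal_intervals Ps. q (\<omega> I \<theta>) (agg N I x) (agg N (left_child N Ps I) x))))"
proof -

  \<comment> \<open>The hypotheses in terms of the tree of splits\<close>
  note dom = dominating_measuresD[OF dominating]
  define T where "T = {(I, L, R). children N Ps I L R}"
  have last: "last Ps = cell N ` {..<N}"
    using cond_A by (simp add: complete_recursive_partition_def)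
  have RS: "recursive_splitting N (cell N ` {..<N}) T" and ints: "intervals Ps = cell N ` {..<N} \<union> fst ` T"
    using recursive_splitting_children[of Ps N] cond_A N_pos
    unfolding last[symmetric] T_def complete_recursive_partition_def by auto
  note inv = recursive_splittingD[OF RS N_pos]
  note inv_grid = inv(7) and inv_fst = inv(5,4,2)
  have in_ints: "I \<in> intervals Ps" "L \<in> intervals Ps" "R \<in> intervals Ps" if "(I, L, R) \<in> T" for I L R
    using inv(8)[OF that] that unfolding ints by force+
  have root: "{0..<1} \<in> intervals Ps" using inv(6) unfolding ints .
  have NT: "nonterminal_intervals Ps = fst ` T"
    using inv_fst unfolding nonterminal_intervals_def ints last by blast
  \<comment> \<open>Injectivity of \<open>fst\<close> on \<open>T\<close> makes the definite
    description in \<open>left_child\<close> well defined.\<close>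
  have left: "left_child N Ps I = L \<and> I - left_child N Ps I = R" if "(I, L, R) \<in> T" for I L R
  proof -
    have "left_child N Ps I = L"
      unfolding left_child_def
    proof (rule the_equality)
      show "\<exists>R. children N Ps I L R" using that by (auto simp: T_def)
      fix L' assume "\<exists>R. children N Ps I L' R"
      then obtain R' where "(I, L', R') \<in> T" by (auto simp: T_def)
      from inj_onD[OF inv_fst(2) _ this that] show "L' = L" by simp
    qed
    then show ?thesis using grid_splitD(5)[OF inv_grid[OF that] N_pos] by simp
  qed
  obtain w where w_inj: "inj_on (\<lambda>(s, t). (s + t, w s t)) (\<Theta> \<times> \<Theta>)"
    and w_cd: "\<And>s t. s \<in> \<Theta> \<Longrightarrow> t \<in> \<Theta> \<Longrightarrow>
      conditional_density (density \<nu> (p s) \<Otimes>\<^sub>M density \<nu> (p t)) \<kappa>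
             (\<lambda>(x\<^sub>1, x\<^sub>2). x\<^sub>1 + x\<^sub>2) (\<lambda>(x\<^sub>1, x\<^sub>2). x\<^sub>1) (q (w s t))"
    and w_AE: "\<And>s t. s \<in> \<Theta> \<Longrightarrow> t \<in> \<Theta> \<Longrightarrow>
      AE (x\<^sub>1, x\<^sub>2) in \<nu> \<Otimes>\<^sub>M \<nu>. p s x\<^sub>1 * p t x\<^sub>2 = p (s + t) (x\<^sub>1 + x\<^sub>2) * q (w s t) (x\<^sub>1 + x\<^sub>2) x\<^sub>1"
    using cond_D unfolding sums_are_cuts_def by blast
  \<comment> \<open>The right child is written as the complement of the left one in
    \<open>I\<close>, so that the parameter depends on \<open>I\<close> and \<open>\<theta>\<close>
    alone.\<close>
  define \<omega> where "\<omega> I \<theta> = w (agg N (left_child N Ps I) \<theta>) (agg N (I - left_child N Ps I) \<theta>)" for I \<theta>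
  have \<omega>: "\<omega> I \<theta> = w (agg N L \<theta>) (agg N R \<theta>)" if "(I, L, R) \<in> T" for I L R \<theta>
    unfolding \<omega>_def left[OF that, THEN conjunct2] unfolding left[OF that, THEN conjunct1] ..
  have repro: "agg N I \<theta> \<in> \<Theta> \<and>
      distributed (\<Pi>\<^sub>M i\<in>idx N I. density \<nu> (p (\<theta> i))) \<nu> (agg N I) (p (agg N I \<theta>))"
    if "I \<in> intervals Ps" "\<theta> \<in> D" for I \<theta>
  proof -
    \<comment> \<open>Condition (C) quantifies over extensional vectors on the block; restricting
      changes neither the aggregate nor the product measure.\<close>
    have "restrict \<theta> (idx N I) \<in> (\<Pi>\<^sub>E i\<in>idx N I. \<Theta>)"
      using cond_B_members[OF that(2)] by (auto simp: idx_def)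
    with cond_C that(1) have "agg N I (restrict \<theta> (idx N I)) \<in> \<Theta> \<and>
      distributed (\<Pi>\<^sub>M i\<in>idx N I. density \<nu> (p (restrict \<theta> (idx N I) i))) \<nu> (agg N I)
        (p (agg N I (restrict \<theta> (idx N I))))"
      unfolding reproducible_def by blast
    then show ?thesis by (simp add: agg_restrict cong: PiM_cong)
  qed
  have distr: "distributed (P \<theta>) \<nu> (\<lambda>a. agg N I (\<lambda>i. X i a)) (p (agg N I \<theta>))"
    if "I \<in> intervals Ps" "\<theta> \<in> D" "idx N I \<noteq> {}" for I \<theta>
    by (rule distributed_agg[where f = "\<lambda>i. p (\<theta> i)"])
      (use that likelihood cond_B_indep cond_B_members repro dom in auto)
  show ?thesis
  proof (intro exI[of _ \<omega>] conjI ballI)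

    \<comment> \<open>Injectivity of the reparameterization\<close>
    show "inj_on (\<lambda>\<theta>. (agg N {0..<1} \<theta>, \<lambda>I\<in>nonterminal_intervals Ps. \<omega> I \<theta>)) D"
    proof (rule inj_onI)
      fix \<theta> \<theta>' assume D: "\<theta> \<in> D" "\<theta>' \<in> D"
        and "(agg N {0..<1} \<theta>, \<lambda>I\<in>nonterminal_intervals Ps. \<omega> I \<theta>) =
             (agg N {0..<1} \<theta>', \<lambda>I\<in>nonterminal_intervals Ps. \<omega> I \<theta>')"
      then have eq: "agg N {0..<1} \<theta> = agg N {0..<1} \<theta>'"
        and r: "(\<lambda>I\<in>fst ` T. \<omega> I \<theta>) = (\<lambda>I\<in>fst ` T. \<omega> I \<theta>')"
        unfolding NT prod.inject by blast+
      have eq\<omega>: "\<omega> I \<theta> = \<omega> I \<theta>'" if "I \<in> fst ` T" for I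
        using fun_cong[OF r, of I] unfolding restrict_apply'[OF that] .
      have "\<forall>K\<in>cell N ` {..<N}. agg N K \<theta> = agg N K \<theta>'"
      proof (rule recursive_splitting_determined[where f = "\<lambda>K. agg N K \<theta>" and f' = "\<lambda>K. agg N K \<theta>'", OF RS eq])
        fix I L R assume t: "(I, L, R) \<in> T" and I: "agg N I \<theta> = agg N I \<theta>'"
        have "\<omega> I \<theta> = \<omega> I \<theta>'" using eq\<omega>[of I] t by force
        then have "(agg N L \<theta>, agg N R \<theta>) = (agg N L \<theta>', agg N R \<theta>')"
          using I repro in_ints[OF t] D
          by (intro inj_onD[OF w_inj]) (auto simp: \<omega>[OF t] agg_split(1)[OF inv_grid[OF t] N_pos])
        then show "agg N L \<theta> = agg N L \<theta>' \<and> agg N R \<theta> = agg N R \<theta>'" by simp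
      qed
      then have "\<And>i. i \<in> {..<N} \<Longrightarrow> \<theta> i = \<theta>' i" by (auto simp: agg_cell)
      \<comment> \<open>Equality of the coordinates below \<open>N\<close> gives equality of
        functions only because L-independence makes \<open>D\<close> an extensional product.\<close>
      moreover have "D \<subseteq> extensional {..<N}"
        using cond_B_L_indep unfolding L_independent_def PiE_def by blast
      ultimately show "\<theta> = \<theta>'" using D by (intro extensionalityI[of _ "{..<N}"]) auto
    qed
  next
    fix \<theta> assume D: "\<theta> \<in> D"
    show "distributed (P \<theta>) \<nu> (\<lambda>a. agg N {0..<1} (\<lambda>i. X i a)) (p (agg N {0..<1} \<theta>))"
      using distr[OF root D] N_pos by (auto simp: idx_unit)

    \<comment> \<open>Conditional densities of the left children\<close>
    show "conditional_density (P \<theta>) \<kappa> (\<lambda>a. agg N I (\<lambda>i. X i a))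
        (\<lambda>a. agg N (left_child N Ps I) (\<lambda>i. X i a)) (q (\<omega> I \<theta>))"
      if I: "I \<in> nonterminal_intervals Ps" for I
    proof -
      obtain L R where t: "(I, L, R) \<in> T" using I unfolding NT by auto
      note s = agg_split[OF inv_grid[OF t] N_pos]
      have L: "distributed (P \<theta>) \<nu> (\<lambda>a. agg N L (\<lambda>i. X i a)) (p (agg N L \<theta>))"
        and R: "distributed (P \<theta>) \<nu> (\<lambda>a. agg N R (\<lambda>i. X i a)) (p (agg N R \<theta>))"
        using distr in_ints[OF t] D s by auto
      let ?T = "\<lambda>a. (agg N L (\<lambda>i. X i a), agg N R (\<lambda>i. X i a))"
      have mT: "?T \<in> P \<theta> \<rightarrow>\<^sub>M \<nu> \<Otimes>\<^sub>M \<nu>" using L R by (intro measurable_Pair) (auto simp: distributed_def)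
      have dT: "distr (P \<theta>) (\<nu> \<Otimes>\<^sub>M \<nu>) ?T = density \<nu> (p (agg N L \<theta>)) \<Otimes>\<^sub>M density \<nu> (p (agg N R \<theta>))"
        using likelihood[OF D] cond_B_indep[OF D] s(2) L R dom
        by (intro distr_agg_pair) auto
      have cT: "conditional_density (density \<nu> (p (agg N L \<theta>)) \<Otimes>\<^sub>M density \<nu> (p (agg N R \<theta>))) \<kappa>
         (\<lambda>(x\<^sub>1, x\<^sub>2). x\<^sub>1 + x\<^sub>2) (\<lambda>(x\<^sub>1, x\<^sub>2). x\<^sub>1) (q (\<omega> I \<theta>))"
        unfolding \<omega>[OF t] using repro in_ints[OF t] D by (intro w_cd) auto
      have "conditional_density (P \<theta>) \<kappa> (\<lambda>a. (\<lambda>(x\<^sub>1, x\<^sub>2). x\<^sub>1 + x\<^sub>2) (?T a))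
          (\<lambda>a. (\<lambda>(x\<^sub>1, x\<^sub>2). x\<^sub>1) (?T a)) (q (\<omega> I \<theta>))"
        by (rule conditional_density_distr[OF dominating mT]) (unfold dT, rule cT)
      then show ?thesis using left[OF t] by (simp add: s(1))
    qed

    \<comment> \<open>Factorization of the likelihood\<close>
    have lik: "AE x in (\<Pi>\<^sub>M i\<in>{..<N}. \<nu>). lik \<theta> x = (\<Prod>i<N. p (\<theta> i) (x i))"
      using cond_B_L_indep D unfolding L_independent_def by blast
    have "AE x in (\<Pi>\<^sub>M i\<in>{..<N}. \<nu>). \<forall>(I, L, R)\<in>T. p (agg N L \<theta>) (agg N L x) * p (agg N R \<theta>) (agg N R x) =
        p (agg N I \<theta>) (agg N I x) * q (\<omega> I \<theta>) (agg N I x) (agg N L x)"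
    \<comment> \<open>There are finitely many splits, so a single null set serves all cut identities
      at once.\<close>
    proof (rule AE_finite_allI[OF inv_fst(3)], clarify)
      fix I L R assume t: "(I, L, R) \<in> T"
      note s = agg_split[OF inv_grid[OF t] N_pos]
      have "AE z in \<nu> \<Otimes>\<^sub>M \<nu>. case z of (y, z) \<Rightarrow> p (agg N L \<theta>) y * p (agg N R \<theta>) z =
          p (agg N I \<theta>) (y + z) * q (\<omega> I \<theta>) (y + z) y"
        unfolding \<omega>[OF t] s(1) using repro in_ints[OF t] D by (intro w_AE) auto
      from AE_PiM_sum_pair[OF dominating _ _ s(3) _ s(4,2) this, of "{..<N}"]
      show "AE x in (\<Pi>\<^sub>M i\<in>{..<N}. \<nu>). p (agg N L \<theta>) (agg N L x) * p (agg N R \<theta>) (agg N R x) =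
        p (agg N I \<theta>) (agg N I x) * q (\<omega> I \<theta>) (agg N I x) (agg N L x)"
        unfolding s(1)[of x for x] by (auto simp: agg_def idx_def subset_eq)
    qed
    then show "AE x in (\<Pi>\<^sub>M i\<in>{..<N}. \<nu>). lik \<theta> x = p (agg N {0..<1} \<theta>) (agg N {0..<1} x) *
              (\<Prod>I\<in>nonterminal_intervals Ps. q (\<omega> I \<theta>) (agg N I x) (agg N (left_child N Ps I) x))"
      using lik
    proof eventually_elim
      case (elim x)
      \<comment> \<open>Each coordinate is rewritten as the aggregate over its cell, which turns the
        independent likelihood into a product over the final partition, ready for
        telescoping.\<close>
      have "lik \<theta> x = (\<Prod>i<N. p (agg N (cell N i) \<theta>) (agg N (cell N i) x))"
        unfolding elim(2) by (intro prod.cong) (auto simp: agg_cell)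
      also have "\<dots> = (\<Prod>K\<in>cell N ` {..<N}. p (agg N K \<theta>) (agg N K x))"
        by (simp add: prod.reindex[OF inj_on_cell])
      also have "\<dots> = p (agg N {0..<1} \<theta>) (agg N {0..<1} x) *
          (\<Prod>I\<in>fst ` T. q (\<omega> I \<theta>) (agg N I x) (agg N (left_child N Ps I) x))"
        by (rule recursive_splitting_prod[OF RS N_pos]) (use elim(1) left in fastforce)
      finally show ?case unfolding NT .
    qed
  qed
qed

end
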